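(* Let $L$ be the operator generated by a kernel $k$ (symmetric, integrable, non-trivial, nonnegative, $k(0)=0$). Suppose that $\sum_{j\in\mathbb{Z}}k(j)^{1-\delta}<\infty$ for some $\delta\in(0,1)$. Then there is a constant $c>0$ such that for every $x\in\mathbb{Z}$ and every $u\in\ell^\infty(\mathbb{Z})$ $$\Psi_{2,\Upsilon}(u)(x)\ \ge\ c\,\big|Lu(x)\big|^{\gamma},\qquad \gamma=\frac{1+\delta}{\delta}>2.$$ In particular, $L$ satisfies $CD_\Upsilon(0,F)$ with the $CD$-function $F(r)=c\,r^\gamma$, $r\ge0$.
   Context: Kernel and operator: $k:\mathbb{Z}\to[0,\infty)$ is not identically zero, $k(0)=0$, $k(j)=k(-j)$ for all $j$, and $|k|_1:=\sum_{j\in\mathbb{Z}}k(j)<\infty$. The operator generated by $k$ is $Lu(x)=\sum_{j\in\mathbb{Z}}k(j)\big(u(x+j)-u(x)\big)$, $x\in\mathbb{Z}$. $\ell^\infty(\mathbb{Z})$ denotes the bounded functions $\mathbb{Z}\to\mathbb{R}$. (For $k(j)=0$ one has $k(j)^{1-\delta}=0$.) Let $\Upsilon(r)=e^r-1-r$, $r\in\mathbb{R}$. For $u,v\in\ell^\infty(\mathbb{Z})$ put $\Psi_\Upsilon(u)(x)=\sum_{y\in\mathbb{Z}}k(x-y)\Upsilon(u(y)-u(x))$, $B_{\Upsilon'}(u,v)(x)=\sum_{y\in\mathbb{Z}}k(x-y)\Upsilon'(u(y)-u(x))(v(y)-v(x))$ and $\Psi_{2,\Upsilon}(u)(x)=\frac12\big(L\Psi_\Upsilon(u)(x)-B_{\Upsilon'}(u,Lu)(x)\big)$.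 A $CD$-function is a continuous $F:[0,\infty)\to[0,\infty)$ with $F(0)=0$, $r\mapsto F(r)/r$ strictly increasing on $(0,\infty)$, and $1/F$ integrable at $\infty$. $L$ satisfies $CD_\Upsilon(0,F)$ if for every $u\in\ell^\infty(\mathbb{Z})$ and every $x\in\mathbb{Z}$: $\Psi_{2,\Upsilon}(u)(x)\ge F(-Lu(x))$ whenever $-Lu(x)\ge 0$ (and $\Psi_{2,\Upsilon}(u)(x)\ge 0$ otherwise). *)

theory Defs
  imports "HOL-Analysis.Analysis"
begin

text \<open>
  Sums over \<open>\<int>\<close> are unordered sums. For a kernel \<open>k\<close> and bounded \<open>u\<close>, \<open>v\<close> all the sums below
  converge absolutely, so the default value of \<open>infsum\<close> for divergent families never occurs.
\<close>

definition jump_kernel :: "(int \<Rightarrow> real) \<Rightarrow> bool" where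
  "jump_kernel k \<longleftrightarrow>
     (\<forall>j. 0 \<le> k j) \<and> (\<exists>j. k j \<noteq> 0) \<and> k 0 = 0 \<and> (\<forall>j. k j = k (- j)) \<and> k summable_on UNIV"

definition linfty :: "(int \<Rightarrow> real) set" where
  "linfty = {u. bounded (range u)}"

definition gen_op :: "(int \<Rightarrow> real) \<Rightarrow> (int \<Rightarrow> real) \<Rightarrow> int \<Rightarrow> real" where
  "gen_op k u x = (\<Sum>\<^sub>\<infinity>j\<in>UNIV. k j * (u (x + j) - u x))"

definition Upsilon :: "real \<Rightarrow> real" where
  "Upsilon r = exp r - 1 - r"

definition Psi :: "(real \<Rightarrow> real) \<Rightarrow> (int \<Rightarrow> real) \<Rightarrow> (int \<Rightarrow> real) \<Rightarrow> int \<Rightarrow> real" where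
  "Psi H k u x = (\<Sum>\<^sub>\<infinity>y\<in>UNIV. k (x - y) * H (u y - u x))"

definition B_form :: "(real \<Rightarrow> real) \<Rightarrow> (int \<Rightarrow> real) \<Rightarrow> (int \<Rightarrow> real) \<Rightarrow> (int \<Rightarrow> real) \<Rightarrow> int \<Rightarrow> real" where
  "B_form H k u v x = (\<Sum>\<^sub>\<infinity>y\<in>UNIV. k (x - y) * H (u y - u x) * (v y - v x))"

definition Psi2_Upsilon :: "(int \<Rightarrow> real) \<Rightarrow> (int \<Rightarrow> real) \<Rightarrow> int \<Rightarrow> real" where
  "Psi2_Upsilon k u x =
     (gen_op k (Psi Upsilon k u) x - B_form (deriv Upsilon) k u (gen_op k u) x) / 2"

text \<open>
  A function on \<open>[0,\<infinity>)\<close> is a total function of which only the values on \<open>{0..}\<close> matter.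
  The first three conditions force \<open>F > 0\<close> on \<open>(0,\<infinity>)\<close>, so \<open>1 / F\<close> is well defined there.
\<close>

definition CD_function :: "(real \<Rightarrow> real) \<Rightarrow> bool" where
  "CD_function F \<longleftrightarrow>
     (\<forall>r\<ge>0. 0 \<le> F r) \<and> F 0 = 0 \<and> strict_mono_on {0<..} (\<lambda>r. F r / r) \<and>
     continuous_on {0..} F \<and>
     (\<exists>R>0. set_integrable lborel {R..} (\<lambda>r. 1 / F r))"

text \<open>The condition \<open>CD\<^sub>\<Upsilon>(0,F)\<close> for the operator generated by \<open>k\<close>.\<close>

definition CD_Upsilon_0 :: "(int \<Rightarrow> real) \<Rightarrow> (real \<Rightarrow> real) \<Rightarrow> bool" where
  "CD_Upsilon_0 k F \<longleftrightarrow>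
     (\<forall>u\<in>linfty. \<forall>x.
        (if - gen_op k u x \<ge> 0 then Psi2_Upsilon k u x \<ge> F (- gen_op k u x)
         else Psi2_Upsilon k u x \<ge> 0))"

end

theory Submission
  imports Defs
begin

text \<open>
  Fix \<open>x\<close> and write \<open>a\<^sub>j = u (x + j) - u x\<close> and
  \<open>s\<^sub>j\<^sub>l = u (x + j + l) - u (x + j) - u (x + l) + u x\<close>. Expanding the operator and the form
  writes \<open>2 * Psi2_Upsilon k u x\<close> as the sum over all \<open>j\<close> and \<open>l\<close> of
  \<open>k j * k l * (exp a\<^sub>l * (exp s\<^sub>j\<^sub>l - 1) - exp a\<^sub>j * s\<^sub>j\<^sub>l)\<close>.
  As \<open>s\<close> is symmetric in \<open>j\<close> and \<open>l\<close>, averaging the summand with the one in which \<open>j\<close> and \<open>l\<close> are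
  exchanged turns the bracket into
  \<open>(exp a\<^sub>j + exp a\<^sub>l) / 2 * Upsilon s\<^sub>j\<^sub>l\<close>, which is nonnegative (lemma \<open>Psi2_Upsilon_eq\<close>).

  Hence any set of pairs may be discarded. Only the pairs \<open>(j, -j)\<close> are kept. For them
  \<open>s = - z\<^sub>j\<close> with \<open>z\<^sub>j = a\<^sub>j + a\<^sub>-\<^sub>j\<close>, and by the symmetry of the kernel \<open>2 L u x\<close> is the sum of
  \<open>k j * z\<^sub>j\<close>; so the surviving terms see exactly the quantities that make up \<open>L u x\<close>. The arithmetic
  mean of the two exponentials is at least \<open>exp (z\<^sub>j / 2)\<close>, and \<open>exp (z / 2) * Upsilon (- z)\<close>
  grows exponentially in both directions and quadratically at \<open>0\<close>. Since \<open>\<gamma> \<ge> 2\<close>, it dominates a multiple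
  of \<open>\<bar>z\<bar> powr \<gamma>\<close> (lemma \<open>antipodal_term_ge\<close>).

  It remains to compare the sum of \<open>k j ^ 2 * \<bar>z\<^sub>j\<bar> powr \<gamma>\<close> with the sum of \<open>k j * \<bar>z\<^sub>j\<bar>\<close>. With weights
  \<open>k j powr (1 - \<delta>)\<close> and values \<open>k j powr \<delta> * \<bar>z\<^sub>j\<bar>\<close> this is Jensen's inequality for the power
  \<open>\<gamma>\<close> (lemma \<open>weighted_power_mean\<close>): the relation \<open>\<delta> * \<gamma> = 1 + \<delta>\<close> is what makes the exponents of
  \<open>k\<close> come out as \<open>2\<close> and \<open>1\<close>, and the summability of \<open>k powr (1 - \<delta>)\<close> makes the total weight finite.
\<close>

section \<open>Elementary inequalities\<close>

lemma deriv_Upsilon: "deriv Upsilon r = exp r - 1"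
proof -
  have "(Upsilon has_real_derivative (exp r - 1)) (at r)"
    unfolding Upsilon_def [abs_def] by (auto intro!: derivative_eq_intros)
  then show ?thesis by (rule DERIV_imp_deriv)
qed

lemma Upsilon_nonneg: "0 \<le> Upsilon r"
  using exp_ge_add_one_self [of r] unfolding Upsilon_def by linarith

lemma Upsilon_ge_power:
  assumes "0 \<le> r" "2 \<le> n"
  shows "r ^ n / fact n \<le> Upsilon r"
proof -
  have "r ^ n / fact n = (\<Sum>i\<in>{n}. r ^ i / fact i)" by simp
  also have "\<dots> \<le> (\<Sum>i\<in>{2..n}. r ^ i / fact i)"
    using assms by (intro sum_mono2) auto
  also have "\<dots> = (\<Sum>i\<le>n. r ^ i / fact i) - 1 - r"
  proof -
    have "{..n} = insert 0 (insert 1 {2..n})" using assms by auto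
    then show ?thesis by simp
  qed
  also have "(\<Sum>i\<le>n. r ^ i / fact i) \<le> exp r"
  proof -
    have "(\<Sum>i\<le>n. inverse (fact i) * r ^ i) \<le> (\<Sum>i. inverse (fact i) * r ^ i)"
      using assms by (intro sum_le_suminf [OF summable_exp]) auto
    then show ?thesis by (simp add: exp_def divide_inverse mult.commute)
  qed
  finally show ?thesis by (simp add: Upsilon_def)
qed

text \<open>
  Rounding \<open>p\<close> up to an integer reduces the bound for \<open>r \<ge> 1\<close> to a single term of the exponential
  series. For \<open>r \<le> 1\<close> the quadratic term dominates, which is where \<open>p \<ge> 2\<close> enters.
\<close>

lemma Upsilon_ge_powr:
  assumes "0 \<le> r" "2 \<le> p"
  shows "r powr p / fact (nat \<lceil>p\<rceil>) \<le> Upsilon r"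
proof -
  define n where "n = nat \<lceil>p\<rceil>"
  have n: "2 \<le> n" "p \<le> real n" using assms unfolding n_def by linarith+
  show ?thesis
  proof (cases "r \<le> 1")
    case True
    have "r powr p \<le> r powr 2" using True assms by (intro powr_mono') auto
    also have "\<dots> = r ^ 2" using assms by simp
    finally have "r powr p \<le> r ^ 2" .
    then have "r powr p / fact n \<le> r ^ 2 / fact 2"
      using n assms fact_mono [of 2 n, where ?'a = real] by (intro frac_le) auto
    also have "\<dots> \<le> Upsilon r" by (rule Upsilon_ge_power) (use assms in auto)
    finally show ?thesis by (simp add: n_def)
  next
    case False
    have "r powr p \<le> r powr real n" using False n by (intro powr_mono) auto
    also have "\<dots> = r ^ n" using False by (simp add: powr_realpow)
    finally have "r powr p / fact n \<le> r ^ n / fact n" by (intro divide_right_mono) auto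
    also have "\<dots> \<le> Upsilon r" by (rule Upsilon_ge_power) (use assms n in auto)
    finally show ?thesis by (simp add: n_def)
  qed
qed

text \<open>
  With \<open>s = z / 2\<close> the right-hand side is \<open>exp (- s) - exp s + 2 * s * exp s\<close>. It exceeds
  \<open>exp s + exp (- s) - 2 = Upsilon s + Upsilon (- s)\<close> by \<open>2 * (1 - exp s + s * exp s)\<close>,
  and this is nonnegative because \<open>1 - s \<le> exp (- s)\<close>. The factor \<open>exp (z / 2)\<close> is
  what makes the bound two-sided: \<open>Upsilon (- z)\<close> alone grows only linearly as \<open>z\<close> tends to infinity.
\<close>

lemma exp_half_Upsilon_ge:
  "Upsilon (\<bar>z\<bar> / 2) \<le> exp (z / 2) * Upsilon (- z)"
proof -
  define s where "s = z / 2"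
  have "Upsilon (\<bar>z\<bar> / 2) \<le> Upsilon s + Upsilon (- s)"
    using Upsilon_nonneg [of s] Upsilon_nonneg [of "- s"] by (cases "z \<ge> 0") (auto simp: s_def)
  also have "\<dots> = exp s + exp (- s) - 2" by (simp add: Upsilon_def)
  also have "\<dots> \<le> exp (- s) - exp s + 2 * s * exp s"
  proof -
    have "exp s * (1 - s) \<le> exp s * exp (- s)"
      using exp_ge_add_one_self [of "- s"] by (intro mult_left_mono) auto
    then show ?thesis by (simp add: algebra_simps flip: exp_add)
  qed
  also have "\<dots> = exp s * Upsilon (- (2 * s))"
  proof -
    have "exp s * exp (- (2 * s)) = exp (- s)" by (simp flip: exp_add)
    then show ?thesis by (simp add: Upsilon_def algebra_simps)
  qed
  finally show ?thesis by (simp add: s_def)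
qed

lemma mean_exp_ge: "exp ((a + b) / 2) \<le> (exp a + exp b) / (2::real)"
proof -
  have "0 \<le> (exp (a / 2) - exp (b / 2))\<^sup>2" by simp
  also have "\<dots> = exp a + exp b - 2 * exp ((a + b) / 2)"
    by (simp add: power2_eq_square algebra_simps add_divide_distrib flip: exp_add)
  finally show ?thesis by simp
qed

text \<open>
  The lower bound for one pair of opposite jumps: \<open>a\<close> and \<open>b\<close> stand for the increments of \<open>u\<close> along \<open>j\<close>
  and \<open>- j\<close>.
\<close>

lemma antipodal_term_ge:
  assumes "2 \<le> p"
  shows "\<bar>a + b\<bar> powr p / (2 powr p * fact (nat \<lceil>p\<rceil>)) \<le> (exp a + exp b) / 2 * Upsilon (- (a + b))"
proof -
  have "\<bar>a + b\<bar> powr p / (2 powr p * fact (nat \<lceil>p\<rceil>)) = (\<bar>a + b\<bar> / 2) powr p / fact (nat \<lceil>p\<rceil>)"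
    by (simp add: powr_divide)
  also have "\<dots> \<le> Upsilon (\<bar>a + b\<bar> / 2)"
    using assms by (intro Upsilon_ge_powr) auto
  also have "\<dots> \<le> exp ((a + b) / 2) * Upsilon (- (a + b))"
    by (rule exp_half_Upsilon_ge)
  also have "\<dots> \<le> (exp a + exp b) / 2 * Upsilon (- (a + b))"
    by (intro mult_right_mono mean_exp_ge Upsilon_nonneg)
  finally show ?thesis .
qed

section \<open>Unordered sums with weights\<close>

lemma summable_on_diff_real:
  fixes f g :: "'a \<Rightarrow> real"
  assumes "f summable_on A" "g summable_on A"
  shows "(\<lambda>x. f x - g x) summable_on A"
  using summable_on_add [OF assms(1) summable_on_cmult_right [OF assms(2), of "- 1"]] by simp

lemma infsum_diff_real:
  fixes f g :: "'a \<Rightarrow> real"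
  assumes "f summable_on A" "g summable_on A"
  shows "(\<Sum>\<^sub>\<infinity>x\<in>A. f x - g x) = infsum f A - infsum g A"
  using infsum_add [OF assms(1) summable_on_cmult_right [OF assms(2), of "- 1"]]
  by (simp add: infsum_uminus)

text \<open>
  Jensen's inequality for \<open>r powr p\<close>, with \<open>w\<close> as an unnormalised weight. Summing the tangent
  inequality of \<open>r powr p\<close> at the weighted mean \<open>m\<close> of \<open>t\<close> gives it directly for infinite sums; the
  tangent inequality is Young's inequality for \<open>r\<close> and \<open>m powr (p - 1)\<close>.
\<close>

lemma weighted_power_mean:
  fixes w t :: "'a \<Rightarrow> real"
  assumes p: "1 < p"
    and w: "\<And>x. x \<in> A \<Longrightarrow> 0 \<le> w x" and t: "\<And>x. x \<in> A \<Longrightarrow> 0 \<le> t x"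
    and sw: "w summable_on A" and st: "(\<lambda>x. w x * t x) summable_on A"
    and sp: "(\<lambda>x. w x * t x powr p) summable_on A"
    and pos: "0 < infsum w A"
  shows "infsum w A powr (1 - p) * (\<Sum>\<^sub>\<infinity>x\<in>A. w x * t x) powr p \<le> (\<Sum>\<^sub>\<infinity>x\<in>A. w x * t x powr p)"
proof -
  define S where "S = infsum w A"
  define T where "T = (\<Sum>\<^sub>\<infinity>x\<in>A. w x * t x)"
  define m where "m = T / S"
  have T0: "0 \<le> T" unfolding T_def using w t by (intro infsum_nonneg) auto
  have S0: "0 < S" using pos by (simp add: S_def)
  have m0: "0 \<le> m" using T0 S0 by (simp add: m_def)
  define q where "q = p / (p - 1)"
  have q: "1 < q" "1 / p + 1 / q = 1" "(p - 1) * q = p"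
    using p by (auto simp: q_def field_simps)
  have tangent: "p * m powr (p - 1) * r - (p - 1) * m powr p \<le> r powr p" if "0 \<le> r" for r
  proof -
    have "r * m powr (p - 1) \<le> r powr p / p + (m powr (p - 1)) powr q / q"
      using p q m0 that by (intro Youngs_inequality) auto
    also have "(m powr (p - 1)) powr q = m powr p" using q by (simp add: powr_powr)
    finally have "p * (r * m powr (p - 1)) \<le> p * (r powr p / p + m powr p / q)"
      using p by (intro mult_left_mono) auto
    also have "\<dots> = r powr p + (p - 1) * m powr p"
      using p by (simp add: q_def field_simps)
    finally show ?thesis by (simp add: algebra_simps)
  qed
  have "p * m powr (p - 1) * T - (p - 1) * m powr p * S
      = (\<Sum>\<^sub>\<infinity>x\<in>A. p * m powr (p - 1) * (w x * t x) - (p - 1) * m powr p * w x)"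
    unfolding S_def T_def
    unfolding infsum_diff_real [OF summable_on_cmult_right [OF st] summable_on_cmult_right [OF sw]]
    by (simp add: infsum_cmult_right')
  also have "\<dots> \<le> (\<Sum>\<^sub>\<infinity>x\<in>A. w x * t x powr p)"
  proof (rule infsum_mono)
    show "(\<lambda>x. p * m powr (p - 1) * (w x * t x) - (p - 1) * m powr p * w x) summable_on A"
      by (intro summable_on_diff_real summable_on_cmult_right st sw)
    show "p * m powr (p - 1) * (w x * t x) - (p - 1) * m powr p * w x \<le> w x * t x powr p"
      if "x \<in> A" for x
      using mult_left_mono [OF tangent [OF t [OF that]] w [OF that]] by (simp add: algebra_simps)
  qed (rule sp)
  also have "p * m powr (p - 1) * T - (p - 1) * m powr p * S = S * m powr p"
  proof -
    have "m powr (p - 1) * T = m powr (p - 1) * m * S" using S0 by (simp add: m_def)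
    also have "m powr (p - 1) * m = m powr p"
      using m0 p by (cases "m = 0") (auto simp: powr_mult_base mult.commute)
    finally show ?thesis by (simp add: algebra_simps)
  qed
  also have "S * m powr p = S powr (1 - p) * T powr p"
    using S0 T0 by (simp add: m_def powr_divide powr_diff)
  finally show ?thesis by (simp add: S_def T_def)
qed

lemma summable_on_weight_mult_bounded:
  fixes w f :: "'a \<Rightarrow> real"
  assumes "w summable_on A" "\<And>x. x \<in> A \<Longrightarrow> 0 \<le> w x" "bounded (f ` A)"
  shows "(\<lambda>x. w x * f x) summable_on A"
proof -
  obtain C where C: "\<And>x. x \<in> A \<Longrightarrow> \<bar>f x\<bar> \<le> C"
    using assms(3) by (auto simp: bounded_iff)
  have "(\<lambda>x. norm (w x * f x)) summable_on A"
  proof (rule Infinite_Sum.abs_summable_on_comparison_test')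
    show "(\<lambda>x. C * w x) summable_on A" using assms by (intro summable_on_cmult_right)
    show "norm (w x * f x) \<le> C * w x" if "x \<in> A" for x
      using C [OF that] assms(2) [OF that] mult_left_mono [of "\<bar>f x\<bar>" C "w x"]
      by (simp add: abs_mult mult.commute)
  qed
  then show ?thesis by (rule Infinite_Sum.abs_summable_summable)
qed

lemma summable_on_product_weight:
  fixes w :: "'a \<Rightarrow> real"
  assumes "w summable_on UNIV" "\<And>x. 0 \<le> w x"
  shows "(\<lambda>p. w (fst p) * w (snd p)) summable_on UNIV"
proof -
  have "(\<lambda>p. w (fst p) * w (snd p)) summable_on (SIGMA x:UNIV. UNIV)"
  proof (rule summable_on_SigmaI)
    show "((\<lambda>y. w (fst (x, y)) * w (snd (x, y))) has_sum w x * infsum w UNIV) UNIV" for x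
      using assms by (auto intro!: has_sum_cmult_right)
    show "(\<lambda>x. w x * infsum w UNIV) summable_on UNIV"
      using assms by (intro summable_on_cmult_left)
  qed (use assms in auto)
  then show ?thesis by simp
qed

text \<open>
  Fubini for weighted sums: the product weight is summable, so a bounded \<open>h\<close> gives an absolutely
  summable family of pairs.
\<close>

lemma iterated_weighted_infsum:
  fixes w :: "'a \<Rightarrow> real" and h :: "'a \<times> 'a \<Rightarrow> real"
  assumes "w summable_on UNIV" "\<And>x. 0 \<le> w x" "bounded (range h)"
  shows "(\<Sum>\<^sub>\<infinity>x. w x * (\<Sum>\<^sub>\<infinity>y. w y * h (x, y))) = (\<Sum>\<^sub>\<infinity>p. w (fst p) * w (snd p) * h p)"
proof -
  have "(\<lambda>p. w (fst p) * w (snd p) * h p) summable_on UNIV"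
    using assms by (intro summable_on_weight_mult_bounded summable_on_product_weight) auto
  then have "(\<lambda>p. w (fst p) * w (snd p) * h p) summable_on (SIGMA x:UNIV. UNIV)" by simp
  from infsum_Sigma_banach [OF this] show ?thesis
    by (simp add: mult.assoc infsum_cmult_right')
qed

section \<open>Sums against a jump kernel\<close>

lemma jump_kernelD:
  assumes "jump_kernel k"
  shows "k summable_on UNIV" "\<And>j. 0 \<le> k j" "\<And>j. k (- j) = k j" "\<exists>j. k j \<noteq> 0"
  using assms by (auto simp: jump_kernel_def)

lemma kernel_infsum_shift:
  assumes "jump_kernel k"
  shows "(\<Sum>\<^sub>\<infinity>y. k (x - y) * f y) = (\<Sum>\<^sub>\<infinity>j. k j * f (x + j))"
proof -
  have "bij_betw (\<lambda>j. x + j) UNIV UNIV" by (rule bij_plus)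
  from infsum_reindex_bij_betw [OF this, of "\<lambda>y. k (x - y) * f y"]
  show ?thesis using jump_kernelD(3) [OF assms] by simp
qed

lemma kernel_powr_infsum_pos:
  assumes k: "jump_kernel k" and "(\<lambda>j. k j powr q) summable_on UNIV"
  shows "0 < (\<Sum>\<^sub>\<infinity>j. k j powr q)"
proof -
  obtain i where i: "k i \<noteq> 0" using jump_kernelD(4) [OF k] by blast
  have "(\<Sum>j\<in>{i}. k j powr q) \<le> (\<Sum>\<^sub>\<infinity>j. k j powr q)"
    using assms(2) by (intro finite_sum_le_infsum) auto
  then have "k i powr q \<le> (\<Sum>\<^sub>\<infinity>j. k j powr q)" by simp
  moreover have "0 < k i powr q" using i by simp
  ultimately show ?thesis by linarith
qed

lemma product_weight_infsum_swap:
  fixes w :: "'a \<Rightarrow> real"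
  shows "(\<Sum>\<^sub>\<infinity>p. w (fst p) * w (snd p) * h (prod.swap p)) = (\<Sum>\<^sub>\<infinity>p. w (fst p) * w (snd p) * h p)"
proof -
  have "bij_betw prod.swap UNIV (UNIV :: ('a \<times> 'a) set)" by (rule bij_swap)
  from infsum_reindex_bij_betw [OF this, of "\<lambda>p. w (fst p) * w (snd p) * h p"]
  show ?thesis by (simp add: mult.commute)
qed

lemma bounded_range_mult:
  fixes f g :: "'a \<Rightarrow> real"
  assumes "bounded (range f)" "bounded (range g)"
  shows "bounded (range (\<lambda>x. f x * g x))"
proof -
  obtain B C where "\<And>x. \<bar>f x\<bar> \<le> B" "\<And>x. \<bar>g x\<bar> \<le> C"
    using assms by (auto simp: bounded_iff)
  then have "\<bar>f x * g x\<bar> \<le> B * C" for x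
    unfolding abs_mult by (intro mult_mono) (auto intro: order_trans [OF abs_ge_zero])
  then show ?thesis by (auto simp: bounded_iff)
qed

lemma bounded_range_exp:
  fixes f :: "'a \<Rightarrow> real"
  assumes "bounded (range f)"
  shows "bounded (range (\<lambda>x. exp (f x)))"
proof -
  obtain B where B: "\<And>x. \<bar>f x\<bar> \<le> B"
    using assms by (auto simp: bounded_iff)
  then have "f x \<le> B" for x using abs_le_D1 by blast
  then show ?thesis by (auto simp: bounded_iff)
qed

lemma bounded_range_compose:
  assumes "bounded (range u)"
  shows "bounded (range (\<lambda>x. u (g x)))"
  by (rule bounded_subset [OF assms]) auto

lemma bounded_range_Upsilon:
  assumes "bounded (range f)"
  shows "bounded (range (\<lambda>x. Upsilon (f x)))"
  unfolding Upsilon_def by (intro bounded_minus_comp bounded_range_exp assms) auto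

lemmas bounded_range_intros =
  bounded_plus_comp bounded_minus_comp bounded_range_mult bounded_range_exp
  bounded_range_Upsilon

text \<open>The mixed second difference of \<open>u\<close> at \<open>x\<close> in the directions \<open>j\<close> and \<open>l\<close>; its symmetry in \<open>j\<close> and
  \<open>l\<close> is the commutativity of the group.\<close>

definition second_diff :: "(int \<Rightarrow> real) \<Rightarrow> int \<Rightarrow> int \<Rightarrow> int \<Rightarrow> real" where
  "second_diff u x j l = u (x + j + l) - u (x + j) - u (x + l) + u x"

lemma gen_op_Psi_Upsilon:
  assumes k: "jump_kernel k" and u: "bounded (range u)"
  shows "gen_op k (Psi Upsilon k u) x =
    (\<Sum>\<^sub>\<infinity>p. k (fst p) * k (snd p) *
      (Upsilon (u (x + fst p + snd p) - u (x + fst p)) - Upsilon (u (x + snd p) - u x)))"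
proof -
  note kD = jump_kernelD [OF k]
  have "Psi Upsilon k u (x + j) - Psi Upsilon k u x =
    (\<Sum>\<^sub>\<infinity>l. k l * (Upsilon (u (x + j + l) - u (x + j)) - Upsilon (u (x + l) - u x)))" for j
    unfolding Psi_def kernel_infsum_shift [OF k] right_diff_distrib
    by (intro infsum_diff_real [symmetric] summable_on_weight_mult_bounded kD(1,2) bounded_range_intros bounded_range_compose [OF u])
  then show ?thesis
    unfolding gen_op_def
    using iterated_weighted_infsum [OF kD(1,2), of "\<lambda>p. Upsilon (u (x + fst p + snd p) - u (x + fst p)) - Upsilon (u (x + snd p) - u x)"]
    by (simp add: bounded_range_intros bounded_range_compose [OF u])
qed

lemma B_form_gen_op:
  assumes k: "jump_kernel k" and u: "bounded (range u)"
  shows "B_form (deriv Upsilon) k u (gen_op k u) x =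
    (\<Sum>\<^sub>\<infinity>p. k (fst p) * k (snd p) *
      ((exp (u (x + fst p) - u x) - 1) * second_diff u x (fst p) (snd p)))"
proof -
  note kD = jump_kernelD [OF k]
  have "gen_op k u (x + j) - gen_op k u x = (\<Sum>\<^sub>\<infinity>l. k l * second_diff u x j l)" for j
  proof -
    have "gen_op k u (x + j) - gen_op k u x =
        (\<Sum>\<^sub>\<infinity>l. k l * (u (x + j + l) - u (x + j)) - k l * (u (x + l) - u x))"
      unfolding gen_op_def
      by (intro infsum_diff_real [symmetric] summable_on_weight_mult_bounded kD(1,2) bounded_range_intros bounded_range_compose [OF u])
    then show ?thesis by (simp add: second_diff_def algebra_simps)
  qed
  then have "B_form (deriv Upsilon) k u (gen_op k u) x =
    (\<Sum>\<^sub>\<infinity>j. k j * (\<Sum>\<^sub>\<infinity>l. k l * ((exp (u (x + j) - u x) - 1) * second_diff u x j l)))"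
    unfolding B_form_def deriv_Upsilon mult.assoc kernel_infsum_shift [OF k]
    by (simp add: mult.left_commute [of "k _"] infsum_cmult_right')
  then show ?thesis
    using iterated_weighted_infsum [OF kD(1,2), of "\<lambda>p. (exp (u (x + fst p) - u x) - 1) * second_diff u x (fst p) (snd p)"]
    by (simp add: bounded_range_intros bounded_range_compose [OF u] second_diff_def)
qed

text \<open>
  The double sum obtained directly has a summand \<open>H\<close> without a sign. The weight \<open>k j * k l\<close> and
  the second difference \<open>s\<close> are invariant under exchanging \<open>j\<close> and \<open>l\<close>, so \<open>H\<close> may be replaced by its
  symmetrisation. There the linear terms \<open>exp a\<^sub>j * s\<close> and \<open>exp a\<^sub>l * s\<close> combine with the exponential ones to
  \<open>Upsilon s\<close>.
\<close>

lemma Psi2_Upsilon_eq: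
  assumes k: "jump_kernel k" and u: "bounded (range u)"
  shows "2 * Psi2_Upsilon k u x =
    (\<Sum>\<^sub>\<infinity>p. k (fst p) * k (snd p) *
      ((exp (u (x + fst p) - u x) + exp (u (x + snd p) - u x)) / 2
         * Upsilon (second_diff u x (fst p) (snd p))))"
proof -
  note kD = jump_kernelD [OF k]
  define W where "W = (\<lambda>p. k (fst p) * k (snd p))"
  define a where "a = (\<lambda>j. u (x + j) - u x)"
  define s where "s = (\<lambda>p. second_diff u x (fst p) (snd p))"
  define H where "H = (\<lambda>p. exp (a (snd p)) * (exp (s p) - 1) - exp (a (fst p)) * s p)"
  have bs: "bounded (range s)"
    unfolding s_def second_diff_def by (intro bounded_range_intros bounded_range_compose [OF u])
  have ba: "bounded (range (\<lambda>p :: int \<times> int. a (fst p)))" "bounded (range (\<lambda>p :: int \<times> int. a (snd p)))"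
    unfolding a_def by (intro bounded_range_intros bounded_range_compose [OF u]; simp)+
  have bH: "bounded (range H)"
    unfolding H_def by (intro bounded_range_intros bs ba) simp
  have W: "W summable_on UNIV" "\<And>p. 0 \<le> W p"
    unfolding W_def using summable_on_product_weight [OF kD(1,2)] kD(2) by auto
  have WH: "(\<lambda>p. W p * H p) summable_on UNIV" "(\<lambda>p. W p * H (prod.swap p)) summable_on UNIV"
    by (intro summable_on_weight_mult_bounded W bH bounded_range_compose [OF bH])+
  have "2 * Psi2_Upsilon k u x = (\<Sum>\<^sub>\<infinity>p. W p * H p)"
  proof -
    have "2 * Psi2_Upsilon k u x =
       (\<Sum>\<^sub>\<infinity>p. W p * (Upsilon (s p + a (snd p)) - Upsilon (a (snd p)))
            - W p * ((exp (a (fst p)) - 1) * s p))"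
    proof -
      have sa: "u (x + fst p + snd p) - u (x + fst p) = s p + a (snd p)" for p
        by (simp add: s_def a_def second_diff_def)
      have P: "(\<lambda>p. W p * (Upsilon (s p + a (snd p)) - Upsilon (a (snd p)))) summable_on UNIV"
        by (intro summable_on_weight_mult_bounded W bounded_range_intros bs ba)
      have Q: "(\<lambda>p. W p * ((exp (a (fst p)) - 1) * s p)) summable_on UNIV"
        by (intro summable_on_weight_mult_bounded W bounded_range_intros bs ba) simp
      have "gen_op k (Psi Upsilon k u) x = (\<Sum>\<^sub>\<infinity>p. W p * (Upsilon (s p + a (snd p)) - Upsilon (a (snd p))))"
        unfolding gen_op_Psi_Upsilon [OF k u] sa W_def a_def ..
      moreover have "B_form (deriv Upsilon) k u (gen_op k u) x = (\<Sum>\<^sub>\<infinity>p. W p * ((exp (a (fst p)) - 1) * s p))"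
        unfolding B_form_gen_op [OF k u] s_def W_def a_def ..
      ultimately show ?thesis
        unfolding Psi2_Upsilon_def infsum_diff_real [OF P Q] by simp
    qed
    also have "\<dots> = (\<Sum>\<^sub>\<infinity>p. W p * H p)"
      by (intro infsum_cong) (simp add: H_def Upsilon_def exp_add algebra_simps)
    finally show ?thesis .
  qed
  also have "\<dots> = ((\<Sum>\<^sub>\<infinity>p. W p * H p) + (\<Sum>\<^sub>\<infinity>p. W p * H (prod.swap p))) / 2"
    using product_weight_infsum_swap [of k H] by (simp add: W_def)
  also have "\<dots> = (\<Sum>\<^sub>\<infinity>p. (W p * H p + W p * H (prod.swap p)) / 2)"
    unfolding divide_inverse infsum_cmult_left' infsum_add [OF WH] ..
  also have "\<dots> = (\<Sum>\<^sub>\<infinity>p. W p * ((exp (a (fst p)) + exp (a (snd p))) / 2 * Upsilon (s p)))"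
  proof (intro infsum_cong)
    fix p :: "int \<times> int"
    have "s (prod.swap p) = s p" by (simp add: s_def second_diff_def algebra_simps)
    then show "(W p * H p + W p * H (prod.swap p)) / 2 = W p * ((exp (a (fst p)) + exp (a (snd p))) / 2 * Upsilon (s p))"
      by (simp add: H_def Upsilon_def field_simps)
  qed
  finally show ?thesis by (simp add: W_def a_def s_def)
qed

text \<open>
  All terms of the symmetrised double sum are nonnegative, so the sum over the pairs \<open>(j, -j)\<close>
  is a lower bound.
\<close>

lemma Psi2_Upsilon_ge_antipodal:
  assumes k: "jump_kernel k" and u: "bounded (range u)"
  shows "(\<Sum>\<^sub>\<infinity>j. k j * k j * ((exp (u (x + j) - u x) + exp (u (x - j) - u x)) / 2
            * Upsilon (- (u (x + j) + u (x - j) - 2 * u x)))) \<le> 2 * Psi2_Upsilon k u x"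
     (is "infsum ?f UNIV \<le> _")
    and "(\<lambda>j. k j * k j * ((exp (u (x + j) - u x) + exp (u (x - j) - u x)) / 2
            * Upsilon (- (u (x + j) + u (x - j) - 2 * u x)))) summable_on UNIV"
proof -
  note kD = jump_kernelD [OF k]
  define G where "G = (\<lambda>p. k (fst p) * k (snd p) *
      ((exp (u (x + fst p) - u x) + exp (u (x + snd p) - u x)) / 2
         * Upsilon (second_diff u x (fst p) (snd p))))"
  have G0: "0 \<le> G p" for p
    unfolding G_def using kD(2) Upsilon_nonneg by (intro mult_nonneg_nonneg) auto
  have G: "G summable_on UNIV"
    unfolding G_def second_diff_def divide_inverse
    by (intro summable_on_weight_mult_bounded summable_on_product_weight kD(1,2)
              bounded_range_intros bounded_range_compose [OF u]) (auto simp: kD(2))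
  define \<iota> where "\<iota> = (\<lambda>j::int. (j, - j))"
  have inj: "inj \<iota>" by (auto simp: \<iota>_def inj_on_def)
  have eq: "G \<circ> \<iota> = ?f"
    by (auto simp: fun_eq_iff G_def \<iota>_def second_diff_def kD(3) algebra_simps)
  have sum: "G summable_on range \<iota>" by (rule summable_on_subset_banach [OF G]) simp
  show "?f summable_on UNIV"
    using sum unfolding summable_on_reindex [OF inj] eq .
  have "infsum ?f UNIV = infsum G (range \<iota>)"
    using infsum_reindex [OF inj, of G] eq by simp
  also have "\<dots> \<le> infsum G UNIV"
    by (intro infsum_mono_neutral sum G) (auto simp: G0)
  also have "\<dots> = 2 * Psi2_Upsilon k u x"
    using Psi2_Upsilon_eq [OF k u, of x] by (simp add: G_def)
  finally show "infsum ?f UNIV \<le> 2 * Psi2_Upsilon k u x" .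
qed

text \<open>
  By the symmetry of \<open>k\<close>, the operator can be written with centred second differences.
\<close>

lemma gen_op_abs_le:
  assumes k: "jump_kernel k" and u: "bounded (range u)"
  shows "2 * \<bar>gen_op k u x\<bar> \<le> (\<Sum>\<^sub>\<infinity>j. k j * \<bar>u (x + j) + u (x - j) - 2 * u x\<bar>)"
    and "(\<lambda>j. k j * \<bar>u (x + j) + u (x - j) - 2 * u x\<bar>) summable_on UNIV"
proof -
  note kD = jump_kernelD [OF k]
  define z where "z = (\<lambda>j. u (x + j) + u (x - j) - 2 * u x)"
  have bz: "bounded (range z)"
    unfolding z_def by (intro bounded_range_intros bounded_range_compose [OF u]) auto
  then have bz': "bounded (range (\<lambda>j. \<bar>z j\<bar>))" by (simp add: bounded_iff)
  show s: "(\<lambda>j. k j * \<bar>u (x + j) + u (x - j) - 2 * u x\<bar>) summable_on UNIV"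
    using summable_on_weight_mult_bounded [OF kD(1,2) bz'] by (simp add: z_def)
  have s1: "(\<lambda>j. k j * (u (x + j) - u x)) summable_on UNIV"
    and s2: "(\<lambda>j. k j * (u (x - j) - u x)) summable_on UNIV"
    by (intro summable_on_weight_mult_bounded kD(1,2) bounded_range_intros bounded_range_compose [OF u]; simp)+
  have "bij_betw uminus UNIV (UNIV :: int set)" by (rule bij_uminus)
  from infsum_reindex_bij_betw [OF this, of "\<lambda>j. k j * (u (x + j) - u x)"]
  have "gen_op k u x = (\<Sum>\<^sub>\<infinity>j. k j * (u (x - j) - u x))"
    by (simp add: gen_op_def kD(3))
  then have "2 * gen_op k u x = (\<Sum>\<^sub>\<infinity>j. k j * (u (x + j) - u x)) + (\<Sum>\<^sub>\<infinity>j. k j * (u (x - j) - u x))"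
    by (simp add: gen_op_def)
  also have "\<dots> = (\<Sum>\<^sub>\<infinity>j. k j * z j)"
    unfolding infsum_add [OF s1 s2, symmetric] by (simp add: z_def algebra_simps)
  finally have "2 * \<bar>gen_op k u x\<bar> = norm (\<Sum>\<^sub>\<infinity>j. k j * z j)" by (metis abs_mult abs_numeral real_norm_def)
  also have "\<dots> \<le> (\<Sum>\<^sub>\<infinity>j. norm (k j * z j))"
    using s by (intro norm_infsum_bound) (simp add: z_def abs_mult kD(2))
  finally show "2 * \<bar>gen_op k u x\<bar> \<le> (\<Sum>\<^sub>\<infinity>j. k j * \<bar>u (x + j) + u (x - j) - 2 * u x\<bar>)"
    by (simp add: z_def abs_mult kD(2))
qed

section \<open>The curvature-dimension inequality\<close>

text \<open>
  The constant combines the factor \<open>2 powr p * fact (nat \<lceil>p\<rceil>)\<close> of \<open>antipodal_term_ge\<close> with the total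
  weight of the power mean. Its \<open>2 powr p\<close> cancels against the one from \<open>2 * \<bar>gen_op k u x\<bar>\<close>.
\<close>

lemma Psi2_Upsilon_ge_powr:
  assumes k: "jump_kernel k" and u: "bounded (range u)"
    and \<delta>: "0 < \<delta>" "\<delta> < 1" and sk: "(\<lambda>j. k j powr (1 - \<delta>)) summable_on UNIV"
    and p: "p = (1 + \<delta>) / \<delta>"
  shows "(\<Sum>\<^sub>\<infinity>j. k j powr (1 - \<delta>)) powr (1 - p) / (2 * fact (nat \<lceil>p\<rceil>)) * \<bar>gen_op k u x\<bar> powr p
           \<le> Psi2_Upsilon k u x"
proof -
  note kD = jump_kernelD [OF k]
  define z where "z = (\<lambda>j. u (x + j) + u (x - j) - 2 * u x)"
  define S where "S = (\<Sum>\<^sub>\<infinity>j. k j powr (1 - \<delta>))"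
  define A where "A = (\<Sum>\<^sub>\<infinity>j. k j * \<bar>z j\<bar>)"
  define D where "D = 2 powr p * (fact (nat \<lceil>p\<rceil>) :: real)"
  have p2: "2 < p" using \<delta> by (simp add: p field_simps)
  have D0: "0 < D" by (simp add: D_def)
  have S0: "0 < S" using kernel_powr_infsum_pos [OF k sk] by (simp add: S_def)
  \<comment> \<open>Splitting \<open>k\<close> into a weight and a value: the exponents of \<open>k\<close> are
     \<open>(1 - \<delta>) + \<delta> = 1\<close> and \<open>(1 - \<delta>) + \<delta> * p = 2\<close>.\<close>
  have t1: "k j powr (1 - \<delta>) * (k j powr \<delta> * \<bar>z j\<bar>) = k j * \<bar>z j\<bar>" for j
    using kD(2) [of j] by (simp flip: powr_add mult.assoc)
  have t2: "k j powr (1 - \<delta>) * (k j powr \<delta> * \<bar>z j\<bar>) powr p = k j * k j * \<bar>z j\<bar> powr p" for j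
  proof -
    have "\<delta> * p = 1 + \<delta>" using \<delta> by (simp add: p)
    then have "k j powr (1 - \<delta>) * (k j powr \<delta>) powr p = k j powr 2"
      by (simp add: powr_powr flip: powr_add)
    also have "\<dots> = k j * k j" using kD(2) [of j] by (simp add: power2_eq_square)
    finally show ?thesis using kD(2) [of j] by (simp add: powr_mult flip: mult.assoc)
  qed
  define g where "g = (\<lambda>j. k j * k j * ((exp (u (x + j) - u x) + exp (u (x - j) - u x)) / 2
            * Upsilon (- (u (x + j) + u (x - j) - 2 * u x))))"
  have g: "g summable_on UNIV" "infsum g UNIV \<le> 2 * Psi2_Upsilon k u x"
    unfolding g_def using Psi2_Upsilon_ge_antipodal [OF k u, of x] by auto
  have le: "k j * k j * \<bar>z j\<bar> powr p \<le> D * g j" for j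
  proof -
    have "\<bar>z j\<bar> powr p / D \<le> (exp (u (x + j) - u x) + exp (u (x - j) - u x)) / 2 * Upsilon (- z j)"
      using antipodal_term_ge [of p "u (x + j) - u x" "u (x - j) - u x"] p2
      by (simp add: z_def D_def algebra_simps)
    then have "k j * k j * (\<bar>z j\<bar> powr p / D) \<le> g j"
      unfolding g_def z_def using kD(2) [of j] by (intro mult_left_mono) auto
    then show ?thesis using D0 by (simp add: field_simps)
  qed
  have sz: "(\<lambda>j. k j * k j * \<bar>z j\<bar> powr p) summable_on UNIV"
    by (rule summable_on_comparison_test [OF summable_on_cmult_right [OF g(1), of D]])
       (auto simp: le kD(2))
  have "S powr (1 - p) * (2 * \<bar>gen_op k u x\<bar>) powr p \<le> S powr (1 - p) * A powr p"
    using gen_op_abs_le(1) [OF k u, of x] p2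
    by (intro mult_left_mono powr_mono2) (auto simp: A_def z_def)
  also have "\<dots> \<le> (\<Sum>\<^sub>\<infinity>j. k j * k j * \<bar>z j\<bar> powr p)"
    using weighted_power_mean [of p UNIV "\<lambda>j. k j powr (1 - \<delta>)" "\<lambda>j. k j powr \<delta> * \<bar>z j\<bar>"]
      p2 sk S0 sz gen_op_abs_le(2) [OF k u, of x]
    unfolding t1 t2 by (simp add: S_def A_def z_def)
  also have "\<dots> \<le> (\<Sum>\<^sub>\<infinity>j. D * g j)"
    by (intro infsum_mono sz summable_on_cmult_right g le)
  also have "\<dots> = D * infsum g UNIV" by (rule infsum_cmult_right')
  also have "\<dots> \<le> D * (2 * Psi2_Upsilon k u x)"
    using D0 g(2) by (intro mult_left_mono) auto
  finally have "2 powr p * (S powr (1 - p) * \<bar>gen_op k u x\<bar> powr p)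
      \<le> 2 powr p * (fact (nat \<lceil>p\<rceil>) * (2 * Psi2_Upsilon k u x))"
    by (simp add: D_def powr_mult mult_ac)
  then have "S powr (1 - p) * \<bar>gen_op k u x\<bar> powr p \<le> fact (nat \<lceil>p\<rceil>) * (2 * Psi2_Upsilon k u x)"
    by (subst (asm) mult_le_cancel_left_pos) auto
  then show ?thesis
    unfolding S_def [symmetric] times_divide_eq_left
    by (subst pos_divide_le_eq) (simp_all only: mult_ac zero_less_mult_iff fact_gt_zero, simp_all)
qed

lemma CD_function_powr:
  assumes "0 < c" "2 < p"
  shows "CD_function (\<lambda>r. c * r powr p)"
  unfolding CD_function_def
proof (intro conjI allI impI)
  show "strict_mono_on {0<..} (\<lambda>r. c * r powr p / r)"
  proof (rule strict_mono_onI)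
    fix r s :: real
    assume "r \<in> {0<..}" "s \<in> {0<..}" "r < s"
    moreover have "c * t powr p / t = c * t powr (p - 1)" if "0 < t" for t
      using that by (simp add: powr_diff)
    ultimately show "c * r powr p / r < c * s powr p / s"
      using assms powr_less_mono2 [of "p - 1" r s] by simp
  qed
  show "continuous_on {0..} (\<lambda>r. c * r powr p)"
    using assms by (intro continuous_on_mult continuous_on_powr' continuous_on_id continuous_on_const) auto
  have "(\<lambda>r. r powr (- p)) absolutely_integrable_on {1..}"
    using has_integral_powr_to_inf [of "- p" 1] assms
    by (intro nonnegative_absolutely_integrable_1) (auto simp: integrable_on_def)
  then have "set_integrable lborel {1..} (\<lambda>r. r powr (- p))"
    unfolding set_integrable_def by (subst (asm) integrable_completion) auto
  then have "set_integrable lborel {1..} (\<lambda>r. (1 / c) * r powr (- p))"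
    by (rule set_integrable_mult_right)
  then have "set_integrable lborel {1..} (\<lambda>r. 1 / (c * r powr p))"
    by (simp add: powr_minus divide_inverse)
  then show "\<exists>R>0. set_integrable lborel {R..} (\<lambda>r. 1 / (c * r powr p))"
    by (intro exI [of _ 1]) auto
qed (use assms in auto)

theorem theorem2p8:
  fixes k :: "int \<Rightarrow> real" and \<delta> \<gamma> :: real
  assumes "jump_kernel k"
    and "0 < \<delta>" and "\<delta> < 1"
    and "(\<lambda>j. k j powr (1 - \<delta>)) summable_on UNIV"
    and "\<gamma> = (1 + \<delta>) / \<delta>"
  shows "\<gamma> > 2 \<and>
    (\<exists>c>0. (\<forall>x. \<forall>u\<in>linfty. Psi2_Upsilon k u x \<ge> c * \<bar>gen_op k u x\<bar> powr \<gamma>) \<and>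
           CD_function (\<lambda>r. c * r powr \<gamma>) \<and>
           CD_Upsilon_0 k (\<lambda>r. c * r powr \<gamma>))"
proof -
  define c where "c = (\<Sum>\<^sub>\<infinity>j. k j powr (1 - \<delta>)) powr (1 - \<gamma>) / (2 * fact (nat \<lceil>\<gamma>\<rceil>))"
  have \<gamma>: "2 < \<gamma>" using assms(2,3) unfolding assms(5) by (simp add: less_divide_eq)
  have c: "0 < c"
    using kernel_powr_infsum_pos [OF assms(1,4)] by (simp add: c_def)
  have bound: "c * \<bar>gen_op k u x\<bar> powr \<gamma> \<le> Psi2_Upsilon k u x" if "u \<in> linfty" for u x
    using Psi2_Upsilon_ge_powr [OF assms(1) _ assms(2-5)] that by (simp add: c_def linfty_def)
  have "CD_Upsilon_0 k (\<lambda>r. c * r powr \<gamma>)"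
    unfolding CD_Upsilon_0_def
  proof (intro ballI allI)
    fix u x
    assume "u \<in> linfty"
    then have "c * \<bar>gen_op k u x\<bar> powr \<gamma> \<le> Psi2_Upsilon k u x" by (rule bound)
    moreover have "0 \<le> c * \<bar>gen_op k u x\<bar> powr \<gamma>" using c by simp
    ultimately show "if - gen_op k u x \<ge> 0 then Psi2_Upsilon k u x \<ge> c * (- gen_op k u x) powr \<gamma>
                     else Psi2_Upsilon k u x \<ge> 0"
      by (auto simp: abs_if split: if_splits)
  qed
  with \<gamma> c bound CD_function_powr [OF c \<gamma>] show ?thesis by blast
qed

end
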